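(* Let $(G,* )$ be a groupoid and let $A,B:G\to\mathbb{R}$ be functions. Assume that there exist $f,g:G\to\mathbb{R}$ such that $$A(x*y)=f(x)f(y)-g(x)g(y)\qquad\text{and}\qquad B(x*y)=f(x)g(y)+g(x)f(y)$$ for all $x,y\in G$. Then the inequalities $$-B(x*y)^2\leq A(x*x)\,A(y*y)\leq A(x*y)^2$$ and $$-A(x*y)^2\leq B(x*x)\,B(y*y)\leq B(x*y)^2$$ hold for all $x,y\in G$.
   Context: A groupoid $(G,* )$ is a set $G$ together with a binary operation $*:G\times G\to G$ (a magma); no associativity, commutativity or other property is assumed. $A(u)^2$ denotes $(A(u))^2$, and $-B(u)^2$ denotes $-\big((B(u))^2\big)$, similarly with $A$ and $B$ exchanged. *)

theory Defs
  imports Complex_Main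
begin

end

theory Submission
  imports Defs
begin

text \<open>
  Put z(x) = f(x) + i g(x). The two functional equations say that A(x * y) and B(x * y) are the
  real and imaginary parts of z(x) z(y). For complex numbers z and w, let p = zw and
  q = z cnj(w). Then Re(z^2) Re(w^2) is half of Re(p^2) + Re(q^2), and Im(z^2) Im(w^2) is half of
  Re(q^2) - Re(p^2). Since p and q have the same modulus r, and Re(p^2) can be written both as
  2 Re(p)^2 - r^2 and as r^2 - 2 Im(p)^2 (likewise for q), each of the two products is a
  difference of squares in two ways: once a square belonging to p minus one belonging to q, once
  the other way round. Dropping the square belonging to q, which is nonnegative, gives an upper
  bound in the first case and a lower bound in the second.
\<close>

lemma Re_square_mult_Re_square:
  "Re (z\<^sup>2) * Re (w\<^sup>2) = (Re (z * w))\<^sup>2 - (Im (z * cnj w))\<^sup>2"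
  "Re (z\<^sup>2) * Re (w\<^sup>2) = (Re (z * cnj w))\<^sup>2 - (Im (z * w))\<^sup>2"
  by (simp_all add: power2_eq_square algebra_simps)

lemma Im_square_mult_Im_square:
  "Im (z\<^sup>2) * Im (w\<^sup>2) = (Im (z * w))\<^sup>2 - (Im (z * cnj w))\<^sup>2"
  "Im (z\<^sup>2) * Im (w\<^sup>2) = (Re (z * cnj w))\<^sup>2 - (Re (z * w))\<^sup>2"
  by (simp_all add: power2_eq_square algebra_simps)

theorem theorem4p1:
  fixes G :: "'a set"
    and mult :: "'a \<Rightarrow> 'a \<Rightarrow> 'a"  (infixl \<open>\<star>\<close> 70)
    and A B :: "'a \<Rightarrow> real"
  assumes closed: "\<And>x y. x \<in> G \<Longrightarrow> y \<in> G \<Longrightarrow> x \<star> y \<in> G"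
    and ex: "\<exists>f g :: 'a \<Rightarrow> real. \<forall>x\<in>G. \<forall>y\<in>G.
               A (x \<star> y) = f x * f y - g x * g y \<and>
               B (x \<star> y) = f x * g y + g x * f y"
  shows "\<forall>x\<in>G. \<forall>y\<in>G.
           - ((B (x \<star> y))\<^sup>2) \<le> A (x \<star> x) * A (y \<star> y) \<and>
           A (x \<star> x) * A (y \<star> y) \<le> (A (x \<star> y))\<^sup>2 \<and>
           - ((A (x \<star> y))\<^sup>2) \<le> B (x \<star> x) * B (y \<star> y) \<and>
           B (x \<star> x) * B (y \<star> y) \<le> (B (x \<star> y))\<^sup>2"
proof (intro ballI)
  fix x y
  assume xy: "x \<in> G" "y \<in> G"
  from ex obtain f g :: "'a \<Rightarrow> real" where
    fg: "\<forall>x\<in>G. \<forall>y\<in>G. A (x \<star> y) = f x * f y - g x * g y \<and>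
                        B (x \<star> y) = f x * g y + g x * f y"
    by blast
  define z where "z u = Complex (f u) (g u)" for u
  have A: "A (u \<star> v) = Re (z u * z v)" and B: "B (u \<star> v) = Im (z u * z v)"
    if "u \<in> G" "v \<in> G" for u v
    using fg that by (simp_all add: z_def)
  have AA: "A (x \<star> x) * A (y \<star> y) = Re ((z x)\<^sup>2) * Re ((z y)\<^sup>2)"
    and BB: "B (x \<star> x) * B (y \<star> y) = Im ((z x)\<^sup>2) * Im ((z y)\<^sup>2)"
    using xy by (simp_all only: A B power2_eq_square)
  have "- ((B (x \<star> y))\<^sup>2) \<le> A (x \<star> x) * A (y \<star> y)"
    unfolding AA Re_square_mult_Re_square(2) B[OF xy] by simp
  moreover have "A (x \<star> x) * A (y \<star> y) \<le> (A (x \<star> y))\<^sup>2"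
    unfolding AA Re_square_mult_Re_square(1) A[OF xy] by simp
  moreover have "- ((A (x \<star> y))\<^sup>2) \<le> B (x \<star> x) * B (y \<star> y)"
    unfolding BB Im_square_mult_Im_square(2) A[OF xy] by simp
  moreover have "B (x \<star> x) * B (y \<star> y) \<le> (B (x \<star> y))\<^sup>2"
    unfolding BB Im_square_mult_Im_square(1) B[OF xy] by simp
  ultimately show "- ((B (x \<star> y))\<^sup>2) \<le> A (x \<star> x) * A (y \<star> y) \<and>
           A (x \<star> x) * A (y \<star> y) \<le> (A (x \<star> y))\<^sup>2 \<and>
           - ((A (x \<star> y))\<^sup>2) \<le> B (x \<star> x) * B (y \<star> y) \<and>
           B (x \<star> x) * B (y \<star> y) \<le> (B (x \<star> y))\<^sup>2"
    by blast
qed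

end
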